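(* Let $n\ge 1$ be an integer and let $a,b_1,\dots,b_n\in[0,1)$ be real numbers, not all equal to $0$. Consider a multi-opponent competition, run by the repeated-draw procedure described in the context, between a protagonist $A$ with winning percentage $a$ and $n$ opponents $B_1,\dots,B_n$ with winning percentages $b_1,\dots,b_n$. Then the probability $P_n(a;b_1,b_2,\dots,b_n)$ that $A$ wins (i.e. defeats all $n$ opponents) is \[ P_n(a;b_1,b_2,\dots,b_n)=\frac{a}{a+(1-a)\displaystyle\sum_{i=1}^n\frac{b_i}{1-b_i}}. \]
   Context: The competition among $A,B_1,\dots,B_n$ is modelled as follows. In each round, every competitor independently draws either $0$ or $1$; $A$ draws $1$ with probability $a$ and each $B_i$ draws $1$ with probability $b_i$ (and $0$ otherwise). If exactly one competitor draws a $1$ in the round, that competitor is declared the winner and the procedure stops; otherwise the procedure is repeated with a new round of draws, independent of all earlier rounds. $P_n(a;b_1,\dots,b_n)$ denotes the probability that $A$ is eventually declared the winner. *)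

theory Defs
  imports "HOL-Probability.Probability"
begin

datatype competitor = Protagonist | Opponent nat

definition competitors :: "nat \<Rightarrow> competitor set" where
  "competitors n = insert Protagonist (Opponent ` {1..n})"

fun win_pct :: "real \<Rightarrow> (nat \<Rightarrow> real) \<Rightarrow> competitor \<Rightarrow> real" where
  "win_pct a b Protagonist = a"
| "win_pct a b (Opponent i) = b i"

(* The outcome of a draw is a Boolean, with True standing for 1 and False for 0. *)
definition round_pmf :: "nat \<Rightarrow> real \<Rightarrow> (nat \<Rightarrow> real) \<Rightarrow> (competitor \<Rightarrow> bool) pmf" where
  "round_pmf n a b = Pi_pmf (competitors n) False (\<lambda>c. bernoulli_pmf (win_pct a b c))"

(* The procedure is embedded in an infinite sequence of independent rounds; the rounds
   after the first decisive one are never looked at. *)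
definition rounds :: "nat \<Rightarrow> real \<Rightarrow> (nat \<Rightarrow> real) \<Rightarrow> (nat \<Rightarrow> competitor \<Rightarrow> bool) measure" where
  "rounds n a b = (\<Pi>\<^sub>M t\<in>(UNIV :: nat set). measure_pmf (round_pmf n a b))"

definition decisive :: "nat \<Rightarrow> (competitor \<Rightarrow> bool) \<Rightarrow> bool" where
  "decisive n x \<longleftrightarrow> (\<exists>!c. c \<in> competitors n \<and> x c)"

definition declared_winner :: "nat \<Rightarrow> (nat \<Rightarrow> competitor \<Rightarrow> bool) \<Rightarrow> competitor \<Rightarrow> bool" where
  "declared_winner n \<omega> c \<longleftrightarrow> c \<in> competitors n \<and>
     (\<exists>t. (\<forall>s<t. \<not> decisive n (\<omega> s)) \<and> decisive n (\<omega> t) \<and> \<omega> t c)"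

definition win_prob :: "nat \<Rightarrow> real \<Rightarrow> (nat \<Rightarrow> real) \<Rightarrow> real" where
  "win_prob n a b = \<P>(\<omega> in rounds n a b. declared_winner n \<omega> Protagonist)"

lemma prob_space_rounds: "prob_space (rounds n a b)"
  unfolding rounds_def by (intro prob_space_PiM prob_space_measure_pmf)

lemma declared_winner_in_sets:
  "{\<omega> \<in> space (rounds n a b). declared_winner n \<omega> c} \<in> sets (rounds n a b)"
proof -
  have *: "Measurable.pred (rounds n a b) (\<lambda>\<omega>. Q (\<omega> t))" for Q t
  proof -
    have "(\<lambda>\<omega>. \<omega> t) \<in> rounds n a b \<rightarrow>\<^sub>M measure_pmf (round_pmf n a b)"
      unfolding rounds_def by (rule measurable_component_singleton) simp
    moreover have "Q \<in> measure_pmf (round_pmf n a b) \<rightarrow>\<^sub>M count_space UNIV"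
      by simp
    ultimately show ?thesis
      by (rule measurable_compose)
  qed
  have [measurable]: "Measurable.pred (rounds n a b) (\<lambda>\<omega>. decisive n (\<omega> t))"
    "Measurable.pred (rounds n a b) (\<lambda>\<omega>. \<omega> t c)" for t
    using *[of "decisive n" t] *[of "\<lambda>x. x c" t] by simp_all
  show ?thesis
    unfolding declared_winner_def by measurable
qed

end

theory Submission
  imports Defs
begin

text \<open>
  Call a round decisive when exactly one competitor draws a \<open>1\<close>; as some winning percentage is
  positive and all are below \<open>1\<close>, this has positive probability. Since the rounds are
  independent and identically distributed, the first decisive one is distributed like a single round
  conditioned on being decisive, so that the probability that \<open>A\<close> wins is the quotient of the
  probability that a round is decisive in favour of \<open>A\<close> by the probability that it is
  decisive at all (\<open>prob_first_hit\<close>).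

  A round is decisive in favour of the competitor \<open>c\<close> with winning percentage \<open>w\<^sub>c\<close> when
  \<open>c\<close> draws \<open>1\<close> and all others draw \<open>0\<close>. The probability of this is the probability that
  everybody draws \<open>0\<close> times the odds \<open>w\<^sub>c / (1 - w\<^sub>c)\<close>
  (\<open>prob_decisive_for\<close>). The first factor is common to all competitors, so it cancels, and
  \<open>A\<close> wins with probability (odds of \<open>A\<close>) / (sum of all odds), which is the asserted formula after
  multiplying numerator and denominator by \<open>1 - a\<close>.
\<close>

text \<open>
  The event that the first trial satisfying \<open>D\<close> also satisfies \<open>W\<close> splits, according to the
  index \<open>t\<close> of that trial, into events that each constrain only the trials up to \<open>t\<close> and hence have
  probability \<open>(1 - d) ^ t * q\<close>, where \<open>d\<close> and \<open>q\<close> are the probabilities of \<open>D\<close> and of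
  \<open>D \<and> W\<close>. Summing this geometric series over \<open>t\<close> gives \<open>q / d\<close>.
\<close>

lemma prob_first_hit:
  fixes p :: "'a pmf" and D W :: "'a \<Rightarrow> bool"
  assumes pos: "measure_pmf.prob p {x. D x} > 0"
  shows "\<P>(\<omega> in (\<Pi>\<^sub>M t\<in>(UNIV :: nat set). measure_pmf p).
           \<exists>t. (\<forall>s<t. \<not> D (\<omega> s)) \<and> D (\<omega> t) \<and> W (\<omega> t))
         = measure_pmf.prob p {x. D x \<and> W x} / measure_pmf.prob p {x. D x}"
proof -
  let ?M = "\<Pi>\<^sub>M t\<in>(UNIV :: nat set). measure_pmf p"
  let ?d = "measure_pmf.prob p {x. D x}" and ?q = "measure_pmf.prob p {x. D x \<and> W x}"
  interpret product_prob_space "\<lambda>_. measure_pmf p" "UNIV :: nat set"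
    by unfold_locales
  define X where "X t s = (if s = t then {x. D x \<and> W x} else {x. \<not> D x})" for t s :: nat
  define E where "E t = {\<omega> \<in> space ?M. \<forall>s\<in>{..t}. \<omega> s \<in> X t s}" for t
  have E_iff: "\<omega> \<in> E t \<longleftrightarrow> (\<forall>s<t. \<not> D (\<omega> s)) \<and> D (\<omega> t) \<and> W (\<omega> t)" for \<omega> t
    by (auto simp: E_def X_def space_PiM lessThan_Suc_atMost[symmetric] lessThan_Suc)
  have E_prod_emb: "E t = prod_emb UNIV (\<lambda>_. measure_pmf p) {..t} (Pi\<^sub>E {..t} (X t))" for t
    by (auto simp: E_def prod_emb_def space_PiM Pi_iff)
  have E_sets: "E t \<in> sets ?M" for t
    unfolding E_prod_emb by (rule sets_PiM_I) auto
  have prob_E: "measure ?M (E t) = (1 - ?d) ^ t * ?q" for t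
  proof -
    have "measure ?M (E t) = (\<Prod>s\<in>{..t}. measure_pmf.prob p (X t s))"
      unfolding E_prod_emb by (rule measure_PiM_emb) auto
    also have "\<dots> = (\<Prod>s\<in>{..<t}. measure_pmf.prob p (X t s)) * measure_pmf.prob p (X t t)"
      by (simp add: lessThan_Suc_atMost[symmetric])
    also have "(\<Prod>s\<in>{..<t}. measure_pmf.prob p (X t s)) = (\<Prod>s\<in>{..<t}. 1 - ?d)"
    proof (rule prod.cong)
      show "measure_pmf.prob p (X t s) = 1 - ?d" if "s \<in> {..<t}" for s
        using that measure_pmf.prob_compl[of "{x. D x}" p]
        by (simp add: X_def Compl_eq_Diff_UNIV[symmetric] Collect_neg_eq)
    qed simp
    finally show ?thesis by (simp add: X_def)
  qed
  have "disjoint_family E"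
    unfolding disjoint_family_on_def set_eq_iff Int_iff E_iff by (metis empty_iff linorder_neqE_nat)
  then have "(\<lambda>t. measure ?M (E t)) sums measure ?M (\<Union>t. E t)"
    using E_sets by (intro finite_measure_UNION) auto
  moreover have "(\<lambda>t. (1 - ?d) ^ t * ?q) sums (1 / (1 - (1 - ?d)) * ?q)"
    using pos measure_pmf.prob_le_1[of p "{x. D x}"]
    by (intro sums_mult2 geometric_sums) simp
  ultimately have "measure ?M (\<Union>t. E t) = ?q / ?d"
    by (simp add: prob_E sums_iff)
  moreover have "(\<Union>t. E t) = {\<omega> \<in> space ?M. \<exists>t. (\<forall>s<t. \<not> D (\<omega> s)) \<and> D (\<omega> t) \<and> W (\<omega> t)}"
    unfolding set_eq_iff UN_iff E_iff mem_Collect_eq by (simp add: space_PiM)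
  ultimately show ?thesis by simp
qed

lemma finite_competitors [simp]: "finite (competitors n)"
  by (simp add: competitors_def)

lemma sum_competitors:
  "(\<Sum>c\<in>competitors n. f c) = f Protagonist + (\<Sum>i=1..n. f (Opponent i))"
  unfolding competitors_def by (subst sum.insert) (auto simp: sum.reindex inj_on_def)

text \<open>
  By independence the probability is the product of \<open>w c\<close> and of all \<open>1 - w c'\<close> with
  \<open>c' \<noteq> c\<close>. Completing the latter to the product over all competitors turns the factor \<open>w c\<close>
  into the odds of \<open>c\<close> and leaves a second factor that is the same for every \<open>c\<close>.
\<close>

lemma prob_decisive_for:
  fixes a :: real and b :: "nat \<Rightarrow> real"
  defines "w \<equiv> win_pct a b"
  assumes w: "\<And>c. c \<in> competitors n \<Longrightarrow> 0 \<le> w c \<and> w c < 1"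
    and c: "c \<in> competitors n"
  shows "measure_pmf.prob (round_pmf n a b) {x. decisive n x \<and> x c}
         = w c / (1 - w c) * (\<Prod>c'\<in>competitors n. 1 - w c')"
proof -
  have "{x. decisive n x \<and> x c} = Pi (competitors n) (\<lambda>c'. {c' = c})"
    using c by (auto simp: decisive_def Pi_def)
  then have "measure_pmf.prob (round_pmf n a b) {x. decisive n x \<and> x c}
      = (\<Prod>c'\<in>competitors n. measure_pmf.prob (bernoulli_pmf (w c')) {c' = c})"
    by (simp add: round_pmf_def w_def measure_Pi_pmf_Pi)
  also have "\<dots> = (\<Prod>c'\<in>competitors n. if c' = c then w c' else 1 - w c')"
    using w by (intro prod.cong) (auto simp: measure_pmf_single less_imp_le)
  also have "\<dots> = w c * (\<Prod>c'\<in>competitors n - {c}. 1 - w c')"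
    using c by (subst prod.remove[of _ c]) auto
  also have "\<dots> = w c / (1 - w c) * (\<Prod>c'\<in>competitors n. 1 - w c')"
    using c w[OF c] by (subst (2) prod.remove[of _ c]) auto
  finally show ?thesis .
qed

lemma prob_decisive:
  fixes a :: real and b :: "nat \<Rightarrow> real"
  defines "w \<equiv> win_pct a b"
  assumes w: "\<And>c. c \<in> competitors n \<Longrightarrow> 0 \<le> w c \<and> w c < 1"
  shows "measure_pmf.prob (round_pmf n a b) {x. decisive n x}
         = (\<Sum>c\<in>competitors n. w c / (1 - w c)) * (\<Prod>c\<in>competitors n. 1 - w c)"
proof -
  have "{x. decisive n x} = (\<Union>c\<in>competitors n. {x. decisive n x \<and> x c})"
    by (auto simp: decisive_def)
  moreover have "disjoint_family_on (\<lambda>c. {x. decisive n x \<and> x c}) (competitors n)"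
    by (auto simp: disjoint_family_on_def decisive_def)
  ultimately have "measure_pmf.prob (round_pmf n a b) {x. decisive n x}
      = (\<Sum>c\<in>competitors n. measure_pmf.prob (round_pmf n a b) {x. decisive n x \<and> x c})"
    by (simp add: measure_pmf.finite_measure_finite_Union)
  also have "\<dots> = (\<Sum>c\<in>competitors n. w c / (1 - w c) * (\<Prod>c'\<in>competitors n. 1 - w c'))"
    using w unfolding w_def by (intro sum.cong refl prob_decisive_for) auto
  finally show ?thesis by (simp add: sum_distrib_right)
qed

theorem theorem1:
  fixes n :: nat and a :: real and b :: "nat \<Rightarrow> real"
  assumes "n \<ge> 1"
    and "0 \<le> a" and "a < 1"
    and "\<And>i. i \<in> {1..n} \<Longrightarrow> 0 \<le> b i \<and> b i < 1"
    and "\<not> (a = 0 \<and> (\<forall>i\<in>{1..n}. b i = 0))"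
  shows "win_prob n a b = a / (a + (1 - a) * (\<Sum>i=1..n. b i / (1 - b i)))"
proof -
  let ?w = "win_pct a b"
  let ?Q = "\<Prod>c\<in>competitors n. 1 - ?w c"
  let ?S = "\<Sum>c\<in>competitors n. ?w c / (1 - ?w c)"
  have w: "0 \<le> ?w c \<and> ?w c < 1" if "c \<in> competitors n" for c
    using that assms(2-4) by (auto simp: competitors_def)
  have Q: "?Q > 0"
    using w by (intro prod_pos) auto
  \<comment> \<open>Some competitor has positive odds, so a round has a positive chance of being decisive.\<close>
  have "\<exists>c\<in>competitors n. ?w c \<noteq> 0"
    using assms(5) by (auto simp: competitors_def)
  then obtain c where "c \<in> competitors n" "?w c \<noteq> 0"
    by blast
  then have S: "?S > 0"
    using w by (intro sum_pos2[of _ c]) (auto simp: less_le)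
  have A: "Protagonist \<in> competitors n"
    by (simp add: competitors_def)
  have "measure_pmf.prob (round_pmf n a b) {x. decisive n x} > 0"
    using Q S by (simp add: prob_decisive w)
  then have "win_prob n a b = measure_pmf.prob (round_pmf n a b) {x. decisive n x \<and> x Protagonist}
      / measure_pmf.prob (round_pmf n a b) {x. decisive n x}"
    unfolding win_prob_def declared_winner_def rounds_def
    using A prob_first_hit[of "round_pmf n a b" "decisive n" "\<lambda>x. x Protagonist"] by simp
  also have "\<dots> = (a / (1 - a) * ?Q) / (?S * ?Q)"
    using A by (simp add: prob_decisive prob_decisive_for w)
  also have "\<dots> = a / (1 - a) / ?S"
    by (rule mult_divide_mult_cancel_right) (use Q in linarith)
  also have "?S = a / (1 - a) + (\<Sum>i=1..n. b i / (1 - b i))"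
    by (simp add: sum_competitors)
  also have "a / (1 - a) / \<dots> = a / ((1 - a) * \<dots>)"
    by simp
  also have "\<dots> = a / (a + (1 - a) * (\<Sum>i=1..n. b i / (1 - b i)))"
    using \<open>a < 1\<close> by (simp add: distrib_left)
  finally show ?thesis .
qed

end
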